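(* Let $(G,\alpha)$ be a weighted graph with expansion $(H,\beta)$. Let $E'$ be a multiset of edges on the vertices of $H$ such that for each pair of vertices $a,b$ of $H$, we have that $a$ and $b$ are in the same connected component of the graph $(V(H),E')$ if and only if $aRb$. Then $$\chi_{G}=\sum_{S\subseteq E'}(-1)^{|S|} \chi_{H+S}.$$
   Context: Graphs are finite; loops and multiple edges are allowed, so the edges $E(G)$ form a finite multiset. A proper colouring is a map $\kappa:V(G)\to\mathbb{Z}^+$ with $\kappa(u)\ne\kappa(v)$ whenever there is an edge $uv$ (so a graph with a loop has none). $\chi_G$ is the chromatic polynomial of $G$: the polynomial with $\chi_G(k)$ equal to the number of proper colourings of $G$ using colours from $k$ available colours, for $k\ge 0$. A composition is a finite ordered list of positive integers (its parts). A composition $\beta$ is a refinement of $\alpha$ (equivalently, $\alpha$ is a coarsening of $\beta$; written $\beta\preccurlyeq\alpha$) if the parts of $\alpha$ are obtained in order by adding together adjacent parts of $\beta$ in order. For a graph $G$ with labelled (ordered) vertices $v_1,\dots,v_N$ and a composition $\alpha=(\alpha_1,\dots,\alpha_N)$, $(G,\alpha)$ denotes the weighted graph in which $v_i$ has weight $\alpha_i$. Relation $R$: given weighted graphs $(G,\alpha)$ and $(H,\beta)$ with $\beta\preccurlyeq\alpha$, for a vertex $v$ of $G$ let $R(v)$ be the set of consecutively labelled vertices of $H$ whose weights are summed to obtain the weight of $v$ when describing $\alpha$ as a coarsening of $\beta$. For vertices $a,b$ of $H$, write $aRb$ if and only if there is a vertex $v$ of $G$ with $a,b\in R(v)$. Expansion: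 $(H,\beta)$ is an expansion of $(G,\alpha)$ if (1) $\beta$ is a refinement of $\alpha$, and (2) for all pairs of vertices $u,v$ (not necessarily distinct) of $G$, there is an edge $uv$ in $E(G)$ if and only if there exists an edge $ab$ in $E(H)$ with $a\in R(u)$ and $b\in R(v)$. $H+S$ is the graph $(V(H),E(H)+S)$ obtained by adding the edges in $S$ to the edge multiset of $H$. The sum over $S\subseteq E'$ treats parallel edges of $E'$ as distinguishable, so it has $2^{|E'|}$ terms. *)

theory Defs
  imports
    "HOL-Library.Uprod"
    "HOL-Library.Multiset"
    "HOL-Library.FuncSet"
    "HOL-Computational_Algebra.Polynomial"
begin

section \<open>Multigraphs\<close>

text \<open>An edge is an unordered pair; \<open>Upair v v\<close> is a loop.\<close>

record 'a mgraph =
  verts :: "'a set"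
  edges :: "'a uprod multiset"

definition mgraph :: "'a mgraph \<Rightarrow> bool" where
  "mgraph G \<longleftrightarrow> finite (verts G) \<and> (\<forall>e \<in># edges G. set_uprod e \<subseteq> verts G)"

definition add_edges :: "'a mgraph \<Rightarrow> 'a uprod multiset \<Rightarrow> 'a mgraph" where
  "add_edges G S = G\<lparr>edges := edges G + S\<rparr>"

definition same_component :: "'a mgraph \<Rightarrow> 'a \<Rightarrow> 'a \<Rightarrow> bool" where
  "same_component G a b \<longleftrightarrow>
     a \<in> verts G \<and> b \<in> verts G \<and> (a, b) \<in> {(x, y). Upair x y \<in># edges G}\<^sup>*"

text \<open>The elements of a multiset with parallel copies told apart. A sum over \<open>S \<subseteq> E'\<close> for a
  multiset \<open>E'\<close> of edges ranges over the \<open>2 ^ size E'\<close> subsets of \<open>copies E'\<close>.\<close>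

definition copies :: "'e multiset \<Rightarrow> ('e \<times> nat) set" where
  "copies E = {(e, i). i < count E e}"

definition forget_copies :: "('e \<times> nat) set \<Rightarrow> 'e multiset" where
  "forget_copies S = image_mset fst (mset_set S)"

lemma finite_copies: "finite (copies E)"
  and card_copies: "card (copies E) = size E"
  and forget_copies_copies: "forget_copies (copies E) = E"
proof -
  have eq: "copies E = Sigma (set_mset E) (\<lambda>e. {..<count E e})"
    by (auto simp: copies_def) (metis count_greater_zero_iff gr_zeroI less_nat_zero_code)
  show fin: "finite (copies E)" by (simp add: eq)
  show "card (copies E) = size E"
    by (simp add: eq card_SigmaI size_multiset_overloaded_eq)
  show "forget_copies (copies E) = E"
  proof (rule multiset_eqI)
    fix x
    have "{p \<in> copies E. fst p = x} = Pair x ` {..<count E x}"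
      by (auto simp: copies_def)
    moreover have "count (forget_copies (copies E)) x = card {p \<in> copies E. fst p = x}"
      by (simp add: forget_copies_def count_image_mset fin vimage_def Int_def conj_commute
          sum.If_cases)
    ultimately show "count (forget_copies (copies E)) x = count E x"
      by (simp add: card_image inj_on_def)
  qed
qed


section \<open>Proper colourings and the chromatic polynomial\<close>

text \<open>Colourings are maps on the vertex set, hence extensional functions on \<open>verts G\<close>.\<close>

definition proper_colouring :: "'a mgraph \<Rightarrow> ('a \<Rightarrow> nat) \<Rightarrow> bool" where
  "proper_colouring G \<kappa> \<longleftrightarrow>
     \<kappa> \<in> verts G \<rightarrow>\<^sub>E {1..} \<and> (\<forall>u v. Upair u v \<in># edges G \<longrightarrow> \<kappa> u \<noteq> \<kappa> v)"

definition num_colourings :: "'a mgraph \<Rightarrow> nat \<Rightarrow> nat" where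
  "num_colourings G k = card {\<kappa>. proper_colouring G \<kappa> \<and> \<kappa> ` verts G \<subseteq> {1..k}}"

definition chromatic_poly :: "'a mgraph \<Rightarrow> int poly" where
  "chromatic_poly G = (THE p. \<forall>k. poly p (int k) = int (num_colourings G k))"

lemma num_monochromatic:
  fixes V :: "'a set" and C :: "('a \<times> 'a) set"
  assumes "finite V" "C \<subseteq> V \<times> V"
  shows "\<exists>n. \<forall>k. card {\<kappa> \<in> V \<rightarrow>\<^sub>E {1..k::nat}. \<forall>(a, b) \<in> C. \<kappa> a = \<kappa> b} = k ^ n"
proof -
  define R where "R = (C \<union> C\<inverse>)\<^sup>*"
  define f where "f x = (SOME y. (x, y) \<in> R)" for x
  have symR: "sym R" unfolding R_def by (rule sym_rtrancl) (auto simp: sym_def)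
  have transR: "trans R" unfolding R_def by (rule trans_rtrancl)
  have fR: "(x, f x) \<in> R" for x
    unfolding f_def by (rule someI[of _ x]) (simp add: R_def)
  have f_eq: "f x = f y" if "(x, y) \<in> R" for x y
  proof -
    have "(x, z) \<in> R \<longleftrightarrow> (y, z) \<in> R" for z
      using that symR transR by (meson symD transD)
    thus ?thesis by (simp add: f_def)
  qed
  have RV: "y \<in> V" if "(x, y) \<in> R" "x \<in> V" for x y
    using that unfolding R_def by (induction rule: rtrancl_induct) (use assms in auto)
  have fV: "f x \<in> V" if "x \<in> V" for x using RV[OF fR that] .
  have ff: "f (f x) = f x" for x using f_eq[OF fR] by simp
  have const: "\<kappa> x = \<kappa> y" if "(x, y) \<in> R" "\<forall>(a, b) \<in> C. \<kappa> a = \<kappa> b" for x y and \<kappa> :: "'a \<Rightarrow> nat"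
    using that(1) unfolding R_def by (induction rule: rtrancl_induct) (use that(2) in auto)
  have "card {\<kappa> \<in> V \<rightarrow>\<^sub>E {1..k}. \<forall>(a, b) \<in> C. \<kappa> a = \<kappa> b} = k ^ card (f ` V)" for k
  proof -
    have "bij_betw (\<lambda>\<kappa>. restrict \<kappa> (f ` V))
        {\<kappa> \<in> V \<rightarrow>\<^sub>E {1..k}. \<forall>(a, b) \<in> C. \<kappa> a = \<kappa> b} (f ` V \<rightarrow>\<^sub>E {1..k})"
    proof (rule bij_betw_byWitness[where f' = "\<lambda>\<kappa>. \<lambda>x\<in>V. \<kappa> (f x)"], goal_cases)
      case 1
      show ?case
      proof
        fix \<kappa> assume \<kappa>: "\<kappa> \<in> {\<kappa> \<in> V \<rightarrow>\<^sub>E {1..k}. \<forall>(a, b) \<in> C. \<kappa> a = \<kappa> b}"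
        have "\<kappa> (f x) = \<kappa> x" for x using const[OF fR, of \<kappa>] \<kappa> by auto
        then show "(\<lambda>x\<in>V. restrict \<kappa> (f ` V) (f x)) = \<kappa>"
          using \<kappa> by (intro ext) (auto simp: PiE_def extensional_def)
      qed
    next
      case 2
      show ?case
        by (intro ballI ext) (auto simp: ff fV PiE_def extensional_def restrict_def)
    next
      case 3
      show ?case using fV by (auto simp: PiE_def Pi_def)
    next
      case 4
      have "f a = f b" if "(a, b) \<in> C" for a b
        by (rule f_eq) (use that in \<open>auto simp: R_def\<close>)
      then show ?case using assms(2) by (fastforce simp: PiE_def Pi_def restrict_def extensional_def)
    qed
    then show ?thesis
      using assms(1) by (simp add: bij_betw_same_card card_PiE)
  qed
  then show ?thesis by blast
qed

lemma colouring_count_poly: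
  fixes V :: "'a set"
  assumes "finite F" "finite V" "F \<subseteq> V \<times> V" "C \<subseteq> V \<times> V"
  shows "\<exists>p. \<forall>k. poly p (int k) = int (card {\<kappa> \<in> V \<rightarrow>\<^sub>E {1..k::nat}.
      (\<forall>(a, b) \<in> F. \<kappa> a \<noteq> \<kappa> b) \<and> (\<forall>(a, b) \<in> C. \<kappa> a = \<kappa> b)})"
  using assms
proof (induction F arbitrary: C rule: finite_induct)
  case empty
  obtain n where "\<forall>k. card {\<kappa> \<in> V \<rightarrow>\<^sub>E {1..k::nat}. \<forall>(a, b) \<in> C. \<kappa> a = \<kappa> b} = k ^ n"
    using num_monochromatic[OF empty(1,3)] by blast
  then show ?case by (intro exI[of _ "monom 1 n"]) (simp add: poly_monom)
next
  case (insert e F)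
  obtain a b where e: "e = (a, b)" by fastforce
  let ?X = "\<lambda>F C k. {\<kappa> \<in> V \<rightarrow>\<^sub>E {1..k::nat}.
      (\<forall>(a, b) \<in> F. \<kappa> a \<noteq> \<kappa> b) \<and> (\<forall>(a, b) \<in> C. \<kappa> a = \<kappa> b)}"
  obtain p where p: "\<forall>k. poly p (int k) = int (card (?X F C k))"
    using insert.IH[of C] insert.prems by auto
  obtain q where q: "\<forall>k. poly q (int k) = int (card (?X F (insert e C) k))"
    using insert.IH[of "insert e C"] insert.prems by auto
  have "int (card (?X (insert e F) C k)) = poly (p - q) (int k)" for k
  proof -
    have fin: "finite (?X F C k)"
      by (rule finite_subset[of _ "V \<rightarrow>\<^sub>E {1..k}"]) (use insert.prems in \<open>auto intro: finite_PiE\<close>)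
    have "?X F C k = ?X (insert e F) C k \<union> ?X F (insert e C) k"
      "?X (insert e F) C k \<inter> ?X F (insert e C) k = {}"
      by (auto simp: e)
    with fin have "card (?X F C k) = card (?X (insert e F) C k) + card (?X F (insert e C) k)"
      by (metis (no_types, lifting) card_Un_disjoint finite_Un)
    with p q show ?thesis by simp
  qed
  then show ?case by metis
qed

lemma chromatic_poly_ex1:
  assumes "mgraph G"
  shows "\<exists>!p. \<forall>k. poly p (int k) = int (num_colourings G k)"
proof -
  let ?F = "{(u, v). Upair u v \<in># edges G}"
  have sub: "?F \<subseteq> verts G \<times> verts G" and fin: "finite (verts G)"
    using assms by (fastforce simp: mgraph_def)+
  have "{\<kappa>. proper_colouring G \<kappa> \<and> \<kappa> ` verts G \<subseteq> {1..k}} =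
      {\<kappa> \<in> verts G \<rightarrow>\<^sub>E {1..k}. (\<forall>(a, b) \<in> ?F. \<kappa> a \<noteq> \<kappa> b) \<and> (\<forall>(a, b) \<in> {}. \<kappa> a = \<kappa> b)}" for k
    by (auto simp: proper_colouring_def PiE_def Pi_def image_subset_iff)
  then obtain p where p: "\<forall>k. poly p (int k) = int (num_colourings G k)"
    using colouring_count_poly[OF finite_subset[OF sub] fin sub, of "{}"] fin
    unfolding num_colourings_def by auto
  moreover have "q = p" if q: "\<forall>k. poly q (int k) = int (num_colourings G k)" for q
  proof (rule ccontr)
    assume "q \<noteq> p"
    then have "finite {x. poly (q - p) x = 0}" by (intro poly_roots_finite) auto
    moreover have "range int \<subseteq> {x. poly (q - p) x = 0}" using p q by auto
    ultimately have "finite (range int)" by (rule rev_finite_subset)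
    then show False by (simp add: finite_image_iff)
  qed
  ultimately show ?thesis by blast
qed

lemma poly_chromatic_poly:
  "mgraph G \<Longrightarrow> poly (chromatic_poly G) (int k) = int (num_colourings G k)"
  unfolding chromatic_poly_def using theI'[OF chromatic_poly_ex1] by blast


section \<open>Compositions, weighted graphs and expansions\<close>

definition composition :: "nat list \<Rightarrow> bool" where
  "composition \<alpha> \<longleftrightarrow> (\<forall>a \<in> set \<alpha>. 0 < a)"

text \<open>\<open>bs\<close> cuts the list \<open>xs\<close> into consecutive nonempty blocks whose total weights are the entries
  of \<open>\<alpha>\<close>.\<close>

definition grouping :: "('x \<Rightarrow> nat) \<Rightarrow> 'x list \<Rightarrow> nat list \<Rightarrow> 'x list list \<Rightarrow> bool" where
  "grouping w xs \<alpha> bs \<longleftrightarrow>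
     concat bs = xs \<and> [] \<notin> set bs \<and> map (\<lambda>b. sum_list (map w b)) bs = \<alpha>"

definition refinement :: "nat list \<Rightarrow> nat list \<Rightarrow> bool" where
  "refinement \<beta> \<alpha> \<longleftrightarrow> (\<exists>bs. grouping (\<lambda>x. x) \<beta> \<alpha> bs)"

text \<open>The list \<open>vs\<close> is the labelling \<open>v\<^sub>1, \<dots>, v\<^sub>N\<close> of the vertices; the \<open>i\<close>-th vertex in it
  has weight \<open>\<alpha> ! i\<close>.\<close>

definition weighted_graph :: "'a mgraph \<Rightarrow> 'a list \<Rightarrow> nat list \<Rightarrow> bool" where
  "weighted_graph G vs \<alpha> \<longleftrightarrow>
     mgraph G \<and> distinct vs \<and> set vs = verts G \<and> composition \<alpha> \<and> length \<alpha> = length vs"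

text \<open>The vertex labelling \<open>ws\<close> of \<open>H\<close>, cut into the blocks whose \<open>\<beta>\<close>-weights add up to the
  parts of \<open>\<alpha>\<close>.\<close>

definition blocks :: "'b list \<Rightarrow> nat list \<Rightarrow> nat list \<Rightarrow> 'b list list" where
  "blocks ws \<beta> \<alpha> = map (map fst) (THE bs. grouping snd (zip ws \<beta>) \<alpha> bs)"

definition R_set :: "'a list \<Rightarrow> nat list \<Rightarrow> 'b list \<Rightarrow> nat list \<Rightarrow> 'a \<Rightarrow> 'b set" where
  "R_set vs \<alpha> ws \<beta> v = (\<Union>i \<in> {i. i < length vs \<and> vs ! i = v}. set (blocks ws \<beta> \<alpha> ! i))"

definition R_rel :: "'a list \<Rightarrow> nat list \<Rightarrow> 'b list \<Rightarrow> nat list \<Rightarrow> 'b \<Rightarrow> 'b \<Rightarrow> bool" where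
  "R_rel vs \<alpha> ws \<beta> a b \<longleftrightarrow> (\<exists>v \<in> set vs. a \<in> R_set vs \<alpha> ws \<beta> v \<and> b \<in> R_set vs \<alpha> ws \<beta> v)"

definition expansion ::
  "'b mgraph \<Rightarrow> 'b list \<Rightarrow> nat list \<Rightarrow> 'a mgraph \<Rightarrow> 'a list \<Rightarrow> nat list \<Rightarrow> bool" where
  "expansion H ws \<beta> G vs \<alpha> \<longleftrightarrow>
     refinement \<beta> \<alpha> \<and>
     (\<forall>u \<in> verts G. \<forall>v \<in> verts G.
        Upair u v \<in># edges G \<longleftrightarrow>
        (\<exists>a \<in> R_set vs \<alpha> ws \<beta> u. \<exists>b \<in> R_set vs \<alpha> ws \<beta> v. Upair a b \<in># edges H))"

lemma append_sum_unique:
  assumes "b @ r = c @ s" "sum_list (map w b) = sum_list (map w c)"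
    "\<forall>x \<in> set (b @ r). 0 < (w x :: nat)"
  shows "b = c"
  using assms
proof (induction b arbitrary: c)
  case Nil
  then show ?case by (cases c) auto
next
  case (Cons x b)
  then show ?case by (cases c) auto
qed

lemma grouping_unique:
  assumes "grouping w xs \<alpha> bs" "grouping w xs \<alpha> cs" "\<forall>x \<in> set xs. 0 < w x"
  shows "bs = cs"
  using assms
proof (induction bs arbitrary: xs \<alpha> cs)
  case Nil
  then show ?case by (auto simp: grouping_def)
next
  case (Cons b bs)
  then obtain c cs' where cs: "cs = c # cs'" by (cases cs) (auto simp: grouping_def)
  have "b = c"
    by (rule append_sum_unique[of b "concat bs" c "concat cs'" w])
      (use Cons.prems in \<open>auto simp: grouping_def cs\<close>)
  moreover have "bs = cs'"
    by (rule Cons.IH[of "concat bs" "tl \<alpha>"])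
      (use Cons.prems \<open>b = c\<close> in \<open>auto simp: grouping_def cs\<close>)
  ultimately show ?case by (simp add: cs)
qed

lemma grouping_map:
  assumes "grouping (\<lambda>x. x) (map w xs) \<alpha> bs"
  shows "\<exists>cs. grouping w xs \<alpha> cs \<and> map (map w) cs = bs"
  using assms
proof (induction bs arbitrary: xs \<alpha>)
  case Nil
  then show ?case by (auto simp: grouping_def)
next
  case (Cons b bs)
  then have "map w xs = b @ concat bs" by (auto simp: grouping_def)
  then obtain ys zs where yz: "xs = ys @ zs" "map w ys = b" "map w zs = concat bs"
    by (metis map_eq_append_conv)
  have "\<exists>cs. grouping w zs (tl \<alpha>) cs \<and> map (map w) cs = bs"
    by (rule Cons.IH) (use Cons.prems yz in \<open>auto simp: grouping_def\<close>)
  then obtain cs where "grouping w zs (tl \<alpha>) cs" "map (map w) cs = bs" by blast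
  then show ?case
    using Cons.prems yz by (intro exI[of _ "ys # cs"]) (auto simp: grouping_def)
qed

lemma grouping_ex1:
  assumes "composition \<beta>" "refinement \<beta> \<alpha>" "length ws = length \<beta>"
  shows "\<exists>!bs. grouping snd (zip ws \<beta>) \<alpha> bs"
proof -
  have "\<exists>bs. grouping snd (zip ws \<beta>) \<alpha> bs"
    using assms(2,3) grouping_map[of snd "zip ws \<beta>"] by (fastforce simp: refinement_def)
  moreover have "\<forall>x \<in> set (zip ws \<beta>). 0 < snd x"
    using assms(1) by (auto simp: composition_def dest: set_zip_rightD)
  ultimately show ?thesis using grouping_unique by blast
qed

end

theory Submission
  imports Defs
begin

text \<open>At \<open>k\<close> colours, exchange the sums over \<open>S\<close> and over the proper colourings \<open>\<kappa>\<close> of \<open>H\<close>: the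
  sets \<open>S\<close> contributing for \<open>\<kappa>\<close> are those consisting of edges of \<open>E'\<close> on which \<open>\<kappa>\<close> is not constant,
  so their signs cancel unless \<open>\<kappa>\<close> is constant on all edges of \<open>E'\<close>, hence on the components of
  \<open>E'\<close>, which are the blocks of the expansion. Such colourings are exactly the pullbacks of the
  proper colourings of \<open>G\<close> along the map sending each vertex of \<open>H\<close> to the vertex of its block.\<close>

section \<open>Signed sums over subsets and colouring counts\<close>

text \<open>Expanding the product over \<open>A\<close> of the factors \<open>- 1 + 1\<close> yields
  one signed term per subset, so the value is \<open>0 ^ card A\<close>.\<close>

lemma sum_Pow_minus_one_power_card:
  assumes "finite A"
  shows "(\<Sum>S \<in> Pow A. (- 1) ^ card S) = (if A = {} then 1 else (0 :: 'a :: comm_ring_1))"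
proof -
  have "(\<Sum>S \<in> Pow A. (- 1) ^ card S) = (\<Prod>x \<in> A. - 1 + (1 :: 'a))"
    by (simp only: prod_add[OF assms]) simp
  also have "\<dots> = (if A = {} then 1 else 0)"
    using assms by (simp add: power_0_left)
  finally show ?thesis .
qed

text \<open>This is the set counted by \<open>num_colourings\<close>, with the bound on the colours
  moved into the codomain of the function space; finiteness is then immediate.\<close>

definition colourings :: "'a mgraph \<Rightarrow> nat \<Rightarrow> ('a \<Rightarrow> nat) set" where
  "colourings G k = {\<kappa> \<in> verts G \<rightarrow>\<^sub>E {1..k}. \<forall>u v. Upair u v \<in># edges G \<longrightarrow> \<kappa> u \<noteq> \<kappa> v}"

lemma num_colourings_eq: "num_colourings G k = card (colourings G k)"
proof -
  have "{\<kappa>. proper_colouring G \<kappa> \<and> \<kappa> ` verts G \<subseteq> {1..k}} = colourings G k"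
    by (auto simp: colourings_def proper_colouring_def PiE_def Pi_def image_subset_iff)
  then show ?thesis by (simp add: num_colourings_def)
qed

lemma finite_colourings: "finite (verts G) \<Longrightarrow> finite (colourings G k)"
  unfolding colourings_def by (rule finite_subset[of _ "verts G \<rightarrow>\<^sub>E {1..k}"]) (auto intro: finite_PiE)

lemma chromatic_poly_eqI:
  assumes "mgraph G" "\<And>k. poly p (int k) = int (num_colourings G k)"
  shows "chromatic_poly G = p"
  using chromatic_poly_ex1[OF assms(1)] poly_chromatic_poly[OF assms(1)] assms(2) by blast

lemma set_forget_copies: "finite S \<Longrightarrow> set_mset (forget_copies S) = fst ` S"
  by (simp add: forget_copies_def)

lemma mem_copies_imp_mem: "(e, i) \<in> copies E \<Longrightarrow> e \<in># E"
  by (auto simp: copies_def) (metis count_greater_zero_iff gr_zeroI less_nat_zero_code)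

lemma mem_imp_mem_copies: "e \<in># E \<Longrightarrow> (e, 0) \<in> copies E"
  by (simp add: copies_def)

lemma mgraph_add_edges:
  assumes "mgraph G" "\<forall>e \<in># E. set_uprod e \<subseteq> verts G"
  shows "mgraph (add_edges G E)"
  using assms by (auto simp: mgraph_def add_edges_def)

text \<open>Inclusion-exclusion over the copies of edges in \<open>E\<close>. Loops fit in: a set
  \<open>S\<close> containing one contributes 0, and on the right a loop imposes no
  condition.\<close>

lemma alternating_sum_num_colourings:
  assumes "finite (verts G)"
  shows "(\<Sum>S \<in> Pow (copies E). (- 1) ^ card S * int (num_colourings (add_edges G (forget_copies S)) k))
    = int (card {\<kappa> \<in> colourings G k. \<forall>u v. Upair u v \<in># E \<longrightarrow> \<kappa> u = \<kappa> v})"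
proof -
  let ?K = "colourings G k"
  \<comment> \<open>\<open>N \<kappa>\<close> collects the edge copies that \<kappa> colours
    properly. Quantifying over every way to write the edge as \<open>Upair u v\<close> avoids
    choosing an order of its ends; a loop never qualifies.\<close>
  define N where "N \<kappa> = {p \<in> copies E. \<forall>u v. fst p = Upair u v \<longrightarrow> \<kappa> u \<noteq> \<kappa> v}"
    for \<kappa> :: "'a \<Rightarrow> nat"
  have finK: "finite ?K" using assms by (rule finite_colourings)
  have NE: "N \<kappa> \<subseteq> copies E" for \<kappa> by (auto simp: N_def)
  \<comment> \<open>Each count becomes a sum of indicators over one fixed set of colourings,
    independent of \<open>S\<close>, so that the two sums can be exchanged.\<close>
  have count: "(- 1) ^ card S * int (num_colourings (add_edges G (forget_copies S)) k) =
      (\<Sum>\<kappa> \<in> ?K. if S \<subseteq> N \<kappa> then (- 1) ^ card S else 0)"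
    if S: "S \<subseteq> copies E" for S
  proof -
    have "finite S" using S finite_copies finite_subset by blast
    have "S \<subseteq> N \<kappa> \<longleftrightarrow> (\<forall>u v. Upair u v \<in> fst ` S \<longrightarrow> \<kappa> u \<noteq> \<kappa> v)" for \<kappa>
      using S unfolding N_def by (auto simp: image_iff) (metis fst_conv)+
    then have "colourings (add_edges G (forget_copies S)) k = {\<kappa> \<in> ?K. S \<subseteq> N \<kappa>}"
      using \<open>finite S\<close> by (simp add: colourings_def add_edges_def set_forget_copies) blast
    then show ?thesis
      using finK by (simp add: num_colourings_eq sum.If_cases Int_def mult.commute)
  qed
  have N_empty: "N \<kappa> = {} \<longleftrightarrow> (\<forall>u v. Upair u v \<in># E \<longrightarrow> \<kappa> u = \<kappa> v)" for \<kappa>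
  proof
    assume empty: "N \<kappa> = {}"
    show "\<forall>u v. Upair u v \<in># E \<longrightarrow> \<kappa> u = \<kappa> v"
    proof (intro allI impI)
      fix u v assume "Upair u v \<in># E"
      \<comment> \<open>Copy number 0 exists as soon as the multiplicity is positive.\<close>
      then have "(Upair u v, 0) \<in> copies E" by (rule mem_imp_mem_copies)
      with empty have "(Upair u v, 0) \<notin> N \<kappa>" by blast
      then show "\<kappa> u = \<kappa> v"
        using \<open>(Upair u v, 0) \<in> copies E\<close> by (auto simp: N_def)
    qed
  next
    assume const: "\<forall>u v. Upair u v \<in># E \<longrightarrow> \<kappa> u = \<kappa> v"
    have "(e, i) \<notin> N \<kappa>" for e i
      using const mem_copies_imp_mem[of e i E] by (cases e) (auto simp: N_def)
    then show "N \<kappa> = {}" by auto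
  qed
  have "(\<Sum>S \<in> Pow (copies E). (- 1) ^ card S * int (num_colourings (add_edges G (forget_copies S)) k))
      = (\<Sum>\<kappa> \<in> ?K. \<Sum>S \<in> Pow (copies E). if S \<subseteq> N \<kappa> then (- 1) ^ card S else 0)"
    by (subst sum.swap) (simp add: count)
  also have "\<dots> = (\<Sum>\<kappa> \<in> ?K. \<Sum>S \<in> Pow (N \<kappa>). (- 1) ^ card S)"
    by (intro sum.cong refl sum.mono_neutral_cong_right)
      (use NE finite_copies in \<open>auto split: if_splits\<close>)
  also have "\<dots> = (\<Sum>\<kappa> \<in> ?K. if N \<kappa> = {} then 1 else 0)"
    by (intro sum.cong refl sum_Pow_minus_one_power_card finite_subset[OF NE finite_copies])
  also have "\<dots> = int (card {\<kappa> \<in> ?K. N \<kappa> = {}})"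
    using finK by (simp add: sum.If_cases Int_def)
  finally show ?thesis by (simp add: N_empty)
qed

section \<open>Colourings of a quotient graph\<close>

text \<open>Up to edge multiplicities, \<open>G\<close> is the quotient of \<open>H\<close> by the
  fibres of \<open>f\<close>. Composition with \<open>f\<close> is a bijection between the two sets,
  inverted by composition with a section of \<open>f\<close>. An edge of \<open>H\<close> inside a
  fibre gives a loop of \<open>G\<close>, and then both sets are empty.\<close>

lemma card_colourings_pullback:
  assumes G: "mgraph G"
    and surj: "f ` verts H = verts G"
    and edge: "\<And>u v. u \<in> verts G \<Longrightarrow> v \<in> verts G \<Longrightarrow> Upair u v \<in># edges G \<longleftrightarrow>
      (\<exists>a \<in> verts H. \<exists>b \<in> verts H. f a = u \<and> f b = v \<and> Upair a b \<in># edges H)"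
    and H: "mgraph H"
  shows "card (colourings G k) =
    card {\<kappa> \<in> colourings H k. \<forall>a \<in> verts H. \<forall>b \<in> verts H. f a = f b \<longrightarrow> \<kappa> a = \<kappa> b}"
    (is "_ = card ?L")
proof -
  \<comment> \<open>\<open>g\<close> picks a representative in each fibre; for colourings constant
    on fibres the choice is immaterial.\<close>
  define g where "g = inv_into (verts H) f"
  have g: "g v \<in> verts H" "f (g v) = v" if "v \<in> verts G" for v
    using that surj by (auto simp: g_def inv_into_into f_inv_into_f)
  have fG: "f a \<in> verts G" if "a \<in> verts H" for a using that surj by blast
  have GV: "u \<in> verts G \<and> v \<in> verts G" if "Upair u v \<in># edges G" for u v
    using G that by (fastforce simp: mgraph_def)
  have HV: "u \<in> verts H \<and> v \<in> verts H" if "Upair u v \<in># edges H" for u v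
    using H that by (fastforce simp: mgraph_def)
  have edge_f: "Upair (f a) (f b) \<in># edges G" if "Upair a b \<in># edges H" for a b
    using that HV[OF that] edge[OF fG fG, of a b] by blast
  have const: "\<kappa> (g (f a)) = \<kappa> a" if "\<kappa> \<in> ?L" "a \<in> verts H" for \<kappa> a
  proof -
    have "g (f a) \<in> verts H" "f (g (f a)) = f a" using g[OF fG[OF that(2)]] by simp_all
    with that show ?thesis by blast
  qed
  have "bij_betw (\<lambda>\<kappa>. \<lambda>a\<in>verts H. \<kappa> (f a)) (colourings G k) ?L"
  proof (rule bij_betw_byWitness[where f' = "\<lambda>\<kappa>. \<lambda>v\<in>verts G. \<kappa> (g v)"])
    show "\<forall>\<kappa> \<in> colourings G k. (\<lambda>v\<in>verts G. (\<lambda>a\<in>verts H. \<kappa> (f a)) (g v)) = \<kappa>"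
      by (intro ballI ext) (auto simp: colourings_def g PiE_def extensional_def restrict_def)
    show "\<forall>\<kappa> \<in> ?L. (\<lambda>a\<in>verts H. (\<lambda>v\<in>verts G. \<kappa> (g v)) (f a)) = \<kappa>"
    proof (intro ballI ext)
      fix \<kappa> a assume \<kappa>: "\<kappa> \<in> ?L"
      show "(\<lambda>a\<in>verts H. (\<lambda>v\<in>verts G. \<kappa> (g v)) (f a)) a = \<kappa> a"
      proof (cases "a \<in> verts H")
        case True
        then show ?thesis using const[OF \<kappa> True] fG by simp
      next
        case False
        have "\<kappa> \<in> extensional (verts H)" using \<kappa> by (simp add: colourings_def PiE_def)
        then show ?thesis using False extensional_arb[of \<kappa> "verts H" a] by simp
      qed
    qed
    show "(\<lambda>\<kappa>. \<lambda>a\<in>verts H. \<kappa> (f a)) ` colourings G k \<subseteq> ?L"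
    proof (rule image_subsetI)
      fix \<kappa> assume \<kappa>: "\<kappa> \<in> colourings G k"
      have "\<kappa> (f a) \<noteq> \<kappa> (f b)" if "Upair a b \<in># edges H" for a b
        using edge_f[OF that] \<kappa> by (simp add: colourings_def)
      then show "(\<lambda>a\<in>verts H. \<kappa> (f a)) \<in> ?L"
        using \<kappa> HV fG by (simp add: colourings_def PiE_def Pi_def)
    qed
    show "(\<lambda>\<kappa>. \<lambda>v\<in>verts G. \<kappa> (g v)) ` ?L \<subseteq> colourings G k"
    proof (rule image_subsetI)
      fix \<kappa> assume \<kappa>: "\<kappa> \<in> ?L"
      then have col: "\<kappa> \<in> colourings H k" by blast
      have "\<kappa> (g u) \<noteq> \<kappa> (g v)" if uv: "Upair u v \<in># edges G" for u v
      proof -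
        \<comment> \<open>The edge of \<open>H\<close> lying over \<open>uv\<close> need not join
          \<open>g u\<close> to \<open>g v\<close>; constancy on fibres transfers the inequality to
          these representatives.\<close>
        obtain a b where "a \<in> verts H" "b \<in> verts H" "f a = u" "f b = v" "Upair a b \<in># edges H"
          using uv edge GV by blast
        moreover from this have "\<kappa> a \<noteq> \<kappa> b" using col by (simp add: colourings_def)
        ultimately show ?thesis using const[OF \<kappa>] by metis
      qed
      then show "(\<lambda>v\<in>verts G. \<kappa> (g v)) \<in> colourings G k"
        using col GV g(1) by (simp add: colourings_def PiE_def Pi_def)
    qed
  qed
  then show ?thesis by (rule bij_betw_same_card)
qed

section \<open>From blocks of labels to a vertex map\<close>

text \<open>Positive weights make the grouping unique, so the \<open>THE\<close> in
  \<open>blocks\<close> denotes a genuine grouping, whose properties survive dropping the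
  weights.\<close>

lemma blocks_partition:
  assumes "composition \<beta>" "refinement \<beta> \<alpha>" "length ws = length \<beta>"
  shows "concat (blocks ws \<beta> \<alpha>) = ws" "[] \<notin> set (blocks ws \<beta> \<alpha>)"
    "length (blocks ws \<beta> \<alpha>) = length \<alpha>"
proof -
  define bs where "bs = (THE bs. grouping snd (zip ws \<beta>) \<alpha> bs)"
  have bs: "grouping snd (zip ws \<beta>) \<alpha> bs"
    unfolding bs_def by (rule theI'[OF grouping_ex1[OF assms]])
  have blocks: "blocks ws \<beta> \<alpha> = map (map fst) bs"
    by (simp add: blocks_def bs_def)
  show "concat (blocks ws \<beta> \<alpha>) = ws"
    using bs assms(3) by (simp add: blocks grouping_def flip: map_concat)
  show "[] \<notin> set (blocks ws \<beta> \<alpha>)" "length (blocks ws \<beta> \<alpha>) = length \<alpha>"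
    using bs by (auto simp: blocks grouping_def)
qed

text \<open>A common member of the head and a later list would occur twice in the concatenation. For
  the blocks, this makes the block index of a vertex of \<open>H\<close> unique.\<close>

lemma distinct_concat_nth_unique:
  assumes "distinct (concat xss)" "i < length xss" "j < length xss"
    "x \<in> set (xss ! i)" "x \<in> set (xss ! j)"
  shows "i = j"
  using assms
proof (induction xss arbitrary: i j)
  case (Cons xs xss)
  have "x \<in> set (concat xss)" if "n < length xss" "x \<in> set (xss ! n)" for n
    using that nth_mem by fastforce
  with Cons show ?case by (cases i; cases j) auto
qed simp

text \<open>The map sends a vertex of \<open>H\<close> to the vertex of \<open>G\<close> whose
  position is the index of its block. This replaces labels and weights by the fibres of a single
  surjection.\<close>

lemma expansion_vertex_map:
  assumes "weighted_graph G vs \<alpha>" "weighted_graph H ws \<beta>" "refinement \<beta> \<alpha>"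
  obtains f where "f ` verts H = verts G"
    "\<And>v. v \<in> verts G \<Longrightarrow> R_set vs \<alpha> ws \<beta> v = {b \<in> verts H. f b = v}"
proof -
  let ?B = "blocks ws \<beta> \<alpha>"
  let ?R = "R_set vs \<alpha> ws \<beta>"
  have vs: "distinct vs" "set vs = verts G" "length \<alpha> = length vs"
    and ws: "distinct ws" "set ws = verts H" "length ws = length \<beta>" "composition \<beta>"
    using assms by (auto simp: weighted_graph_def)
  note B = blocks_partition[OF ws(4) assms(3) ws(3)]
  \<comment> \<open>The union defining \<open>R_set\<close> has a single member because the labels
    in \<open>vs\<close> are distinct.\<close>
  have R_nth: "?R (vs ! i) = set (?B ! i)" if "i < length vs" for i
  proof -
    have "{j. j < length vs \<and> vs ! j = vs ! i} = {i}"
      using that vs(1) by (auto simp: nth_eq_iff_index_eq)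
    then show ?thesis by (simp add: R_set_def)
  qed
  define idx where "idx b = (SOME i. i < length vs \<and> b \<in> set (?B ! i))" for b
  have idx: "idx b < length vs \<and> b \<in> set (?B ! idx b)" if "b \<in> verts H" for b
  proof -
    have "b \<in> set (concat ?B)" using that B(1) ws(2) by simp
    then have "\<exists>i. i < length vs \<and> b \<in> set (?B ! i)"
      using B(3) vs(3) by (auto simp: in_set_conv_nth[of _ ?B])
    then show ?thesis unfolding idx_def by (rule someI_ex)
  qed
  have BH: "set (?B ! i) \<subseteq> verts H" if "i < length vs" for i
  proof -
    have "?B ! i \<in> set ?B" using that B(3) vs(3) by simp
    then have "set (?B ! i) \<subseteq> set (concat ?B)" by auto
    then show ?thesis using B(1) ws(2) by simp
  qed
  have idx_eq: "idx b = i" if "i < length vs" "b \<in> set (?B ! i)" for b i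
    using distinct_concat_nth_unique[of ?B "idx b" i b] idx[of b] BH[of i] that B ws(1) vs(3) by auto
  have R: "?R v = {b \<in> verts H. vs ! idx b = v}" if v: "v \<in> verts G" for v
  proof -
    obtain i where i: "i < length vs" "v = vs ! i"
      using v vs(2) by (metis in_set_conv_nth)
    have "set (?B ! i) = {b \<in> verts H. vs ! idx b = v}"
    proof (intro subset_antisym subsetI)
      fix b assume "b \<in> set (?B ! i)"
      then show "b \<in> {b \<in> verts H. vs ! idx b = v}" using BH i idx_eq by blast
    next
      fix b assume b: "b \<in> {b \<in> verts H. vs ! idx b = v}"
      then have "idx b = i" using idx[of b] i vs(1) by (auto simp: nth_eq_iff_index_eq)
      then show "b \<in> set (?B ! i)" using idx[of b] b by auto
    qed
    then show ?thesis using R_nth i by simp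
  qed
  \<comment> \<open>Surjectivity rests on the blocks being nonempty.\<close>
  have nonempty: "?R v \<noteq> {}" if v: "v \<in> verts G" for v
  proof -
    obtain i where i: "i < length vs" "v = vs ! i"
      using v vs(2) by (metis in_set_conv_nth)
    then have "?B ! i \<in> set ?B" using B(3) vs(3) by simp
    then have "?B ! i \<noteq> []" using B(2) by metis
    then show ?thesis using R_nth i by simp
  qed
  have "(\<lambda>b. vs ! idx b) ` verts H = verts G"
  proof
    show "(\<lambda>b. vs ! idx b) ` verts H \<subseteq> verts G" using idx vs(2) nth_mem by blast
    show "verts G \<subseteq> (\<lambda>b. vs ! idx b) ` verts H"
    proof
      fix v assume "v \<in> verts G"
      with R nonempty have "{b \<in> verts H. vs ! idx b = v} \<noteq> {}" by metis
      then show "v \<in> (\<lambda>b. vs ! idx b) ` verts H" by blast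
    qed
  qed
  with R show thesis using that by blast
qed

section \<open>Components as fibres, and the polynomial identity\<close>

lemma const_on_same_component:
  assumes "same_component G a b" "\<forall>u v. Upair u v \<in># edges G \<longrightarrow> \<kappa> u = \<kappa> v"
  shows "\<kappa> a = \<kappa> b"
proof -
  have "(a, b) \<in> {(x, y). Upair x y \<in># edges G}\<^sup>*"
    using assms(1) by (simp add: same_component_def)
  then show ?thesis by (induction rule: rtrancl_induct) (use assms(2) in auto)
qed

theorem corollary3p7:
  fixes G :: "'a mgraph" and vs :: "'a list" and \<alpha> :: "nat list"
    and H :: "'b mgraph" and ws :: "'b list" and \<beta> :: "nat list"
    and E' :: "'b uprod multiset"
  assumes "weighted_graph G vs \<alpha>"
    and "weighted_graph H ws \<beta>"
    and "expansion H ws \<beta> G vs \<alpha>"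
    and "\<forall>e \<in># E'. set_uprod e \<subseteq> verts H"
    and "\<forall>a \<in> verts H. \<forall>b \<in> verts H.
           same_component \<lparr>verts = verts H, edges = E'\<rparr> a b \<longleftrightarrow> R_rel vs \<alpha> ws \<beta> a b"
  shows "chromatic_poly G =
    (\<Sum>S \<in> Pow (copies E'). (- 1) ^ card S * chromatic_poly (add_edges H (forget_copies S)))"
proof -
  have G: "mgraph G" "set vs = verts G" and H: "mgraph H"
    using assms(1,2) by (auto simp: weighted_graph_def)
  have ref: "refinement \<beta> \<alpha>" using assms(3) by (simp add: expansion_def)
  obtain f where f: "f ` verts H = verts G"
    and R: "\<And>v. v \<in> verts G \<Longrightarrow> R_set vs \<alpha> ws \<beta> v = {b \<in> verts H. f b = v}"
    using expansion_vertex_map[OF assms(1,2) ref] by blast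
  have edge: "Upair u v \<in># edges G \<longleftrightarrow>
      (\<exists>a \<in> verts H. \<exists>b \<in> verts H. f a = u \<and> f b = v \<and> Upair a b \<in># edges H)"
    if "u \<in> verts G" "v \<in> verts G" for u v
    using assms(3) that R by (auto simp: expansion_def)
  \<comment> \<open>\<open>R_rel\<close> is the kernel of \<open>f\<close> on
    \<open>verts H\<close>, so the components of \<open>E'\<close> are its fibres.\<close>
  have comp: "same_component \<lparr>verts = verts H, edges = E'\<rparr> a b \<longleftrightarrow> f a = f b"
    if "a \<in> verts H" "b \<in> verts H" for a b
  proof -
    have "R_rel vs \<alpha> ws \<beta> a b \<longleftrightarrow> f a = f b"
      using that f R G(2) by (auto simp: R_rel_def)
    then show ?thesis using assms(5) that by simp
  qed
  \<comment> \<open>This matches the colourings that survive the cancellation with those pulled back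
    from \<open>G\<close>.\<close>
  have const: "(\<forall>u v. Upair u v \<in># E' \<longrightarrow> \<kappa> u = \<kappa> v) \<longleftrightarrow>
      (\<forall>a \<in> verts H. \<forall>b \<in> verts H. f a = f b \<longrightarrow> \<kappa> a = \<kappa> b)" for \<kappa> :: "'b \<Rightarrow> nat"
  proof (intro iffI ballI allI impI)
    fix a b assume "\<forall>u v. Upair u v \<in># E' \<longrightarrow> \<kappa> u = \<kappa> v" "a \<in> verts H" "b \<in> verts H" "f a = f b"
    then show "\<kappa> a = \<kappa> b"
      using const_on_same_component[of "\<lparr>verts = verts H, edges = E'\<rparr>" a b \<kappa>] comp[of a b] by simp
  next
    fix u v assume \<kappa>: "\<forall>a \<in> verts H. \<forall>b \<in> verts H. f a = f b \<longrightarrow> \<kappa> a = \<kappa> b"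
      and uv: "Upair u v \<in># E'"
    then have "u \<in> verts H" "v \<in> verts H" using assms(4) by fastforce+
    moreover from this have "same_component \<lparr>verts = verts H, edges = E'\<rparr> u v"
      using uv by (auto simp: same_component_def)
    ultimately show "\<kappa> u = \<kappa> v" using \<kappa> comp by blast
  qed
  \<comment> \<open>Well-formedness ensures that the \<open>THE\<close> in
    \<open>chromatic_poly\<close> takes the right values for every summand.\<close>
  have add: "mgraph (add_edges H (forget_copies S))" if "S \<subseteq> copies E'" for S
  proof -
    have "finite S" using that finite_copies finite_subset by blast
    then show ?thesis
      using that H assms(4)
      by (intro mgraph_add_edges) (auto simp: set_forget_copies dest!: mem_copies_imp_mem subsetD)
  qed
  show ?thesis
  proof (rule chromatic_poly_eqI[OF G(1)])
    fix k
    have "poly (\<Sum>S \<in> Pow (copies E'). (- 1) ^ card S * chromatic_poly (add_edges H (forget_copies S))) (int k)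
        = (\<Sum>S \<in> Pow (copies E'). (- 1) ^ card S * int (num_colourings (add_edges H (forget_copies S)) k))"
      by (simp add: poly_sum poly_chromatic_poly add)
    also have "\<dots> = int (card {\<kappa> \<in> colourings H k. \<forall>u v. Upair u v \<in># E' \<longrightarrow> \<kappa> u = \<kappa> v})"
      using H by (intro alternating_sum_num_colourings) (simp add: mgraph_def)
    also have "\<dots> = int (num_colourings G k)"
      by (simp add: const num_colourings_eq card_colourings_pullback[OF G(1) f edge H])
    finally show "poly (\<Sum>S \<in> Pow (copies E'). (- 1) ^ card S *
        chromatic_poly (add_edges H (forget_copies S))) (int k) = int (num_colourings G k)" .
  qed
qed

end
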